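(* Consider a component-wise WENO reconstruction of the conserved vector $\mathbf U$ at a point $(x_0,y_0)$ of a cell $I_{i_0}$, with stencils $S_1,\dots,S_r$ (all containing $I_{i_0}$), direct polynomial reconstructions $\mathbf q_k(x,y)$ of $\mathbf U$ on $S_k$, linear weights $\lambda_k$ with $\sum_k\lambda_k=1$, and nonlinear weights $\omega_k^{(j)}$ for component $j$ with $\sum_k\omega_k^{(j)}=1$. Modify it by using the unified nonlinear weights $\omega_k:=\omega_k^{(j^\star)}$, $k=1,\dots,r$, where $j^\star=\min\bigl(\arg\max_j\max_{1\le k\le r}|\omega_k^{(j)}-\lambda_k|\bigr)$, for every component of $\mathbf U$, so that $$\mathbf q^{\mathrm{WENO}}(x_0,y_0)=\sum_{k=1}^r\omega_k\,\mathbf q_k(x_0,y_0).$$ Assume that every cell in the combined stencil $\bigcup_{k=1}^rS_k$ belongs to the same material (hence shares the identical parameters $\gamma$ and $B$) and that all those cells have the same velocity $\mathbf v^*$ and pressure $p^*$. Then $\mathbf q^{\mathrm{WENO}}(x_0,y_0)\in\mathcal G(\mathbf v^*,p^*;\gamma,B)$. Consequently, the unified-weight modification equips general WENO reconstructions with the equilibrium-compatible (EC) property.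
   Context: States. $\mathbf U=(\rho,\rho\mathbf v^\top,E)^\top\in\mathbb R^4$, with $E=\rho e+\frac12\rho|\mathbf v|^2$ and stiffened equation of state $p=(\gamma-1)\rho e-\gamma B$, $\gamma>1$, $B\ge0$. $\mathcal G(\mathbf v^*,p^*;\gamma,B)=\{(\rho,(\rho\mathbf v^* )^\top,\frac{p^*+\gamma B}{\gamma-1}+\frac12\rho|\mathbf v^*|^2)^\top:\rho>0\}$. Direct polynomial reconstruction. Let $\{I_i\}_{i=1}^N$ be the cells of a two-dimensional mesh, $\mathcal M_{0,0}(I_i)=|I_i|$ the volume of $I_i$, and $\overline U_{i,l}$ the $l$-th component of the cell average $\overline{\mathbf U}_i=\mathbf U_h^{\mathrm{tot}}(I_i)/\mathcal M_{0,0}(I_i)$, where $\mathbf U_h^{\mathrm{tot}}(I_i)$ is the total of $\mathbf U$ in $I_i$. Given a stencil $S$ and the space $\mathbb P_k$ of polynomials of total degree at most $k$, a direct polynomial reconstruction in $I_{i_0}$ is an operator that maps $\{\overline U_{i,l}:i\in S\}$ to a polynomial $p_l\in\mathbb P_k$ satisfying: (1) there is a subset $S_0\subset S$ with $i_0\in S_0$ such that $\frac1{\mathcal M_{0,0}(I_i)}\int_{I_i}p_l\,\mathrm dx\,\mathrm dy=\overline U_{i,l}$ for every $i\in S_0$; (2) when the number of cells in $S$ exceeds the number of degrees of freedom in $\mathbb P_k$, $p_l$ is determined by minimizing $\sum_{i\in S\setminus S_0}\alpha_i\bigl|\frac1{\mathcal M_{0,0}(I_i)}\int_{I_i}p_l\,\mathrm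 dx\,\mathrm dy-\overline U_{i,l}\bigr|^q$, with user-defined weights $\alpha_i>0$ and $q\ge1$. For the vector $\mathbf U$ it is performed separately on each component. WENO reconstruction of a scalar $u$ at $(x_0,y_0)\in I_{i_0}$. Build direct reconstructions $q_k$ on $S_k$; choose (possibly negative) linear weights $\lambda_k$, $\sum_k\lambda_k=1$, so that $\sum_k\lambda_kq_k(x_0,y_0)$ reproduces the desired high-order polynomial approximation at $(x_0,y_0)$; from smoothness indicators $\beta_k$ of the $q_k$ define nonlinear weights $\omega_k(\beta_1,\dots,\beta_r;\lambda_1,\dots,\lambda_r)$, $\sum_k\omega_k=1$; the reconstructed value is $\sum_k\omega_kq_k(x_0,y_0)$. Component-wise means this is done for each component of $\mathbf U$, with nonlinear weights in general differing across components. EC property. A reconstruction is EC if, whenever all cell-averaged conserved variables in the reconstruction stencil share a uniform velocity $\mathbf v^*$ and pressure $p^*$, the reconstructed point values reproduce exactly $\mathbf v^*$ and $p^*$.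
   Formalization: Membership in G is claimed only if the reconstructed density is positive (else just the equilibrium formula), EC only if it is nonzero; each direct reconstruction's conditions must determine a unique polynomial for all data, with S_0, weights and q fixed and the same for every component. *)

theory Defs
  imports "HOL-Analysis.Analysis"
begin

type_synonym point = "real \<times> real"

text \<open>
  A state is \<open>(\<rho>, \<rho> v\<^sub>1, \<rho> v\<^sub>2, E)\<close>. Components are addressed as \<open>U $ 1, ..., U $ 4\<close>; note that
  \<open>4 = 0\<close> in the index type, so whenever the order of the components matters they are indexed
  by the naturals \<open>{1..4}\<close> and accessed via \<^const>\<open>of_nat\<close>.
\<close>

type_synonym state = "real ^ 4"

definition mass_density :: "state \<Rightarrow> real" where
  "mass_density U = U $ 1"

definition momentum :: "state \<Rightarrow> real ^ 2" where
  "momentum U = vector [U $ 2, U $ 3]"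

definition total_energy :: "state \<Rightarrow> real" where
  "total_energy U = U $ 4"

definition velocity :: "state \<Rightarrow> real ^ 2" where
  "velocity U = momentum U /\<^sub>R mass_density U"

text \<open>The product \<open>\<rho> e\<close> of density and specific internal energy.\<close>

definition internal_energy :: "state \<Rightarrow> real" where
  "internal_energy U = total_energy U - 1 / 2 * mass_density U * (norm (velocity U))\<^sup>2"

definition pressure :: "real \<Rightarrow> real \<Rightarrow> state \<Rightarrow> real" where
  "pressure \<gamma> B U = (\<gamma> - 1) * internal_energy U - \<gamma> * B"

definition equilibrium_state :: "real ^ 2 \<Rightarrow> real \<Rightarrow> real \<Rightarrow> real \<Rightarrow> real \<Rightarrow> state" where
  "equilibrium_state v p \<gamma> B \<rho> =
     vector [\<rho>, \<rho> * v $ 1, \<rho> * v $ 2, (p + \<gamma> * B) / (\<gamma> - 1) + 1 / 2 * \<rho> * (norm v)\<^sup>2]"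

definition equilibrium_set :: "real ^ 2 \<Rightarrow> real \<Rightarrow> real \<Rightarrow> real \<Rightarrow> state set" where
  "equilibrium_set v p \<gamma> B = {equilibrium_state v p \<gamma> B \<rho> | \<rho>. \<rho> > 0}"

definition mesh :: "nat \<Rightarrow> (nat \<Rightarrow> point set) \<Rightarrow> bool" where
  "mesh N I \<longleftrightarrow>
     (\<forall>i\<in>{1..N}. bounded (I i) \<and> I i \<in> sets lebesgue \<and> measure lebesgue (I i) > 0) \<and>
     (\<forall>i\<in>{1..N}. \<forall>j\<in>{1..N}. i \<noteq> j \<longrightarrow> negligible (I i \<inter> I j))"

definition cell_average :: "(nat \<Rightarrow> point set) \<Rightarrow> (nat \<Rightarrow> state) \<Rightarrow> nat \<Rightarrow> state" where
  "cell_average I Utot i = Utot i /\<^sub>R measure lebesgue (I i)"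

definition cell_mean :: "point set \<Rightarrow> (point \<Rightarrow> real) \<Rightarrow> real" where
  "cell_mean A f = (LINT z:A|lebesgue. f z) / measure lebesgue A"

text \<open>Polynomials in two real variables are represented by their polynomial functions.\<close>

definition monomials :: "nat \<Rightarrow> (nat \<times> nat) set" where
  "monomials k = {(a, b). a + b \<le> k}"

definition polys :: "nat \<Rightarrow> (point \<Rightarrow> real) set" where
  "polys k = {f. \<exists>c. f = (\<lambda>(x, y). \<Sum>(a, b)\<in>monomials k. c (a, b) * x ^ a * y ^ b)}"

definition dof :: "nat \<Rightarrow> nat" where
  "dof k = card (monomials k)"

definition interpolants ::
  "(nat \<Rightarrow> point set) \<Rightarrow> nat set \<Rightarrow> nat \<Rightarrow> (nat \<Rightarrow> real) \<Rightarrow> (point \<Rightarrow> real) set" where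
  "interpolants I S\<^sub>0 k d = {f \<in> polys k. \<forall>i\<in>S\<^sub>0. cell_mean (I i) f = d i}"

definition misfit ::
  "(nat \<Rightarrow> point set) \<Rightarrow> nat set \<Rightarrow> (nat \<Rightarrow> real) \<Rightarrow> real \<Rightarrow> (nat \<Rightarrow> real) \<Rightarrow> (point \<Rightarrow> real) \<Rightarrow> real" where
  "misfit I T \<alpha> q d f = (\<Sum>i\<in>T. \<alpha> i * \<bar>cell_mean (I i) f - d i\<bar> powr q)"

definition direct_solutions ::
  "(nat \<Rightarrow> point set) \<Rightarrow> nat set \<Rightarrow> nat set \<Rightarrow> nat \<Rightarrow> (nat \<Rightarrow> real) \<Rightarrow> real \<Rightarrow> (nat \<Rightarrow> real) \<Rightarrow>
   (point \<Rightarrow> real) set" where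
  "direct_solutions I S S\<^sub>0 k \<alpha> q d =
     {f \<in> interpolants I S\<^sub>0 k d.
        card S > dof k \<longrightarrow> is_arg_min (misfit I (S - S\<^sub>0) \<alpha> q d) (\<lambda>g. g \<in> interpolants I S\<^sub>0 k d) f}"

text \<open>
  A direct reconstruction is an operator on cell data, so its defining conditions must determine
  the polynomial: the solution set is required to be a singleton. Without uniqueness the operator
  could pick unrelated solutions for proportional data. The choice of \<open>S\<^sub>0\<close>, the weights
  \<open>\<alpha>\<close> and the exponent \<open>q\<close> belongs to the operator and does not depend on the data.
\<close>

definition direct_reconstruction ::
  "(nat \<Rightarrow> point set) \<Rightarrow> nat \<Rightarrow> nat set \<Rightarrow> nat \<Rightarrow> ((nat \<Rightarrow> real) \<Rightarrow> point \<Rightarrow> real) \<Rightarrow> bool" where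
  "direct_reconstruction I i\<^sub>0 S k R \<longleftrightarrow>
     (\<exists>S\<^sub>0 \<alpha> q. S\<^sub>0 \<subseteq> S \<and> i\<^sub>0 \<in> S\<^sub>0 \<and> (\<forall>i\<in>S - S\<^sub>0. \<alpha> i > 0) \<and> q \<ge> 1 \<and>
        (\<forall>d. direct_solutions I S S\<^sub>0 k \<alpha> q d = {R d}))"

text \<open>
  In the following, \<open>lw\<close> are the linear weights, \<open>\<beta> k\<close> is the smoothness indicator applied to the
  \<open>k\<close>-th polynomial, and \<open>w b lw k\<close> is the \<open>k\<close>-th nonlinear weight computed from the indicator
  values \<open>b\<close>. Only the indices \<open>1, ..., r\<close> are meaningful.
\<close>

definition nonlinear_weights ::
  "(nat \<Rightarrow> (nat \<Rightarrow> real) \<Rightarrow> point \<Rightarrow> real) \<Rightarrow> (nat \<Rightarrow> real) \<Rightarrow> (nat \<Rightarrow> (point \<Rightarrow> real) \<Rightarrow> real) \<Rightarrow>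
   ((nat \<Rightarrow> real) \<Rightarrow> (nat \<Rightarrow> real) \<Rightarrow> nat \<Rightarrow> real) \<Rightarrow> (nat \<Rightarrow> real) \<Rightarrow> nat \<Rightarrow> real" where
  "nonlinear_weights R lw \<beta> w d = w (\<lambda>k. \<beta> k (R k d)) lw"

text \<open>
  A scalar WENO scheme at \<open>z\<^sub>0\<close>; \<open>Q d\<close> is the desired high-order polynomial approximation, which the
  linearly weighted sum reproduces at \<open>z\<^sub>0\<close>.
\<close>

definition weno_scheme ::
  "nat \<Rightarrow> (nat \<Rightarrow> point set) \<Rightarrow> nat \<Rightarrow> point \<Rightarrow> nat \<Rightarrow> (nat \<Rightarrow> nat set) \<Rightarrow> (nat \<Rightarrow> nat) \<Rightarrow>
   (nat \<Rightarrow> (nat \<Rightarrow> real) \<Rightarrow> point \<Rightarrow> real) \<Rightarrow> nat \<Rightarrow> ((nat \<Rightarrow> real) \<Rightarrow> point \<Rightarrow> real) \<Rightarrow>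
   (nat \<Rightarrow> real) \<Rightarrow> (nat \<Rightarrow> (point \<Rightarrow> real) \<Rightarrow> real) \<Rightarrow>
   ((nat \<Rightarrow> real) \<Rightarrow> (nat \<Rightarrow> real) \<Rightarrow> nat \<Rightarrow> real) \<Rightarrow> bool" where
  "weno_scheme N I i\<^sub>0 z\<^sub>0 r S deg R K Q lw \<beta> w \<longleftrightarrow>
     z\<^sub>0 \<in> I i\<^sub>0 \<and>
     (\<forall>k\<in>{1..r}. S k \<subseteq> {1..N} \<and> direct_reconstruction I i\<^sub>0 (S k) (deg k) (R k)) \<and>
     (\<Sum>k = 1..r. lw k) = 1 \<and>
     (\<forall>d. Q d \<in> polys K \<and> (\<Sum>k = 1..r. lw k * R k d z\<^sub>0) = Q d z\<^sub>0) \<and>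
     (\<forall>d. (\<Sum>k = 1..r. nonlinear_weights R lw \<beta> w d k) = 1)"

definition weight_deviation :: "nat \<Rightarrow> (nat \<Rightarrow> real) \<Rightarrow> (nat \<Rightarrow> nat \<Rightarrow> real) \<Rightarrow> nat \<Rightarrow> real" where
  "weight_deviation r lw \<omega> j = (MAX k\<in>{1..r}. \<bar>\<omega> j k - lw k\<bar>)"

definition unified_index :: "nat \<Rightarrow> (nat \<Rightarrow> real) \<Rightarrow> (nat \<Rightarrow> nat \<Rightarrow> real) \<Rightarrow> nat" where
  "unified_index r lw \<omega> = Min {j. is_arg_max (weight_deviation r lw \<omega>) (\<lambda>j. j \<in> {1..4}) j}"

definition componentwise_weights ::
  "(nat \<Rightarrow> (nat \<Rightarrow> real) \<Rightarrow> point \<Rightarrow> real) \<Rightarrow> (nat \<Rightarrow> real) \<Rightarrow>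
   (nat \<Rightarrow> nat \<Rightarrow> (point \<Rightarrow> real) \<Rightarrow> real) \<Rightarrow>
   (nat \<Rightarrow> (nat \<Rightarrow> real) \<Rightarrow> (nat \<Rightarrow> real) \<Rightarrow> nat \<Rightarrow> real) \<Rightarrow> (nat \<Rightarrow> state) \<Rightarrow> nat \<Rightarrow> nat \<Rightarrow> real" where
  "componentwise_weights R lw \<beta> w U j = nonlinear_weights R lw (\<beta> j) (w j) (\<lambda>i. U i $ of_nat j)"

definition vector_reconstruction ::
  "((nat \<Rightarrow> real) \<Rightarrow> point \<Rightarrow> real) \<Rightarrow> (nat \<Rightarrow> state) \<Rightarrow> point \<Rightarrow> state" where
  "vector_reconstruction R U z = (\<chi> l. R (\<lambda>i. U i $ l) z)"

definition unified_weno ::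
  "point \<Rightarrow> nat \<Rightarrow> (nat \<Rightarrow> (nat \<Rightarrow> real) \<Rightarrow> point \<Rightarrow> real) \<Rightarrow> (nat \<Rightarrow> real) \<Rightarrow>
   (nat \<Rightarrow> nat \<Rightarrow> (point \<Rightarrow> real) \<Rightarrow> real) \<Rightarrow>
   (nat \<Rightarrow> (nat \<Rightarrow> real) \<Rightarrow> (nat \<Rightarrow> real) \<Rightarrow> nat \<Rightarrow> real) \<Rightarrow> (nat \<Rightarrow> state) \<Rightarrow> state" where
  "unified_weno z\<^sub>0 r R lw \<beta> w U =
     (let \<omega> = componentwise_weights R lw \<beta> w U;
          js = unified_index r lw \<omega>
      in \<Sum>k = 1..r. \<omega> js k *\<^sub>R vector_reconstruction (R k) U z\<^sub>0)"

definition has_velocity_pressure :: "real \<Rightarrow> real \<Rightarrow> real ^ 2 \<Rightarrow> real \<Rightarrow> state \<Rightarrow> bool" where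
  "has_velocity_pressure \<gamma> B v p U \<longleftrightarrow> velocity U = v \<and> pressure \<gamma> B U = p"

text \<open>
  The EC property of an operator \<open>Rec\<close> mapping cell averages to a point value, with stencil \<open>C\<close>.
  Velocity and pressure of the reconstructed value are only defined when its density does not
  vanish; high-order reconstructions of positive averages do not guarantee this.
\<close>

definition equilibrium_compatible :: "nat set \<Rightarrow> ((nat \<Rightarrow> state) \<Rightarrow> state) \<Rightarrow> bool" where
  "equilibrium_compatible C Rec \<longleftrightarrow>
     (\<forall>\<gamma> B v p U. \<gamma> > 1 \<longrightarrow> B \<ge> 0 \<longrightarrow>
        (\<forall>i\<in>C. mass_density (U i) > 0 \<and> has_velocity_pressure \<gamma> B v p (U i)) \<longrightarrow>
        mass_density (Rec U) \<noteq> 0 \<longrightarrow> has_velocity_pressure \<gamma> B v p (Rec U))"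

end

theory Submission imports Defs begin

(* At equilibrium the conserved components are affine functions of the density, with coefficients
   depending only on v, p, gamma and B. A direct reconstruction commutes with affine maps of the
   data, because such a map multiplies the misfit by a constant and the solution is unique. Summing
   with weights that add up to one preserves the affine relations, provided that every component
   uses the same weights. *)

lemma vector_4 [simp]:
  "(vector [x, y, z, t] :: ('a::zero) ^ 4) $ 1 = x"
  "(vector [x, y, z, t] :: ('a::zero) ^ 4) $ 2 = y"
  "(vector [x, y, z, t] :: ('a::zero) ^ 4) $ 3 = z"
  "(vector [x, y, z, t] :: ('a::zero) ^ 4) $ 4 = t"
  unfolding vector_def by simp_all

section \<open>Polynomials and their cell means\<close>

lemma finite_monomials: "finite (monomials k)"
  by (rule finite_subset[of _ "{..k} \<times> {..k}"]) (auto simp: monomials_def)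

lemma polys_affine:
  assumes "f \<in> polys k"
  shows "(\<lambda>z. a + b * f z) \<in> polys k"
proof -
  obtain c where f: "f = (\<lambda>(x, y). \<Sum>(i, j)\<in>monomials k. c (i, j) * x ^ i * y ^ j)"
    using assms by (auto simp: polys_def)
  \<comment> \<open>The shift by \<open>a\<close> is absorbed into the coefficient of the monomial
    of degree zero, which is available in every \<open>monomials k\<close>.\<close>
  define c' where "c' = (\<lambda>m. (if m = (0, 0) then a else 0) + b * c m)"
  have zero: "(0, 0) \<in> monomials k"
    by (simp add: monomials_def)
  have "(\<Sum>(i, j)\<in>monomials k. c' (i, j) * x ^ i * y ^ j) = a + b * f (x, y)" for x y
  proof -
    have "(\<Sum>(i, j)\<in>monomials k. c' (i, j) * x ^ i * y ^ j) =
        (\<Sum>m\<in>monomials k. (if m = (0, 0) then a else 0) +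
           b * (c m * x ^ fst m * y ^ snd m))"
      by (intro sum.cong refl) (auto simp: c'_def algebra_simps split: if_splits)
    also have "\<dots> = a + b * (\<Sum>m\<in>monomials k. c m * x ^ fst m * y ^ snd m)"
      using zero finite_monomials[of k]
      by (simp add: sum.distrib sum.delta flip: sum_distrib_left)
    finally show ?thesis
      by (simp add: f case_prod_unfold)
  qed
  then have "(\<lambda>z. a + b * f z) = (\<lambda>(x, y). \<Sum>(i, j)\<in>monomials k. c' (i, j) * x ^ i * y ^ j)"
    by (auto simp: fun_eq_iff)
  then show ?thesis
    unfolding polys_def by blast
qed

lemma const_in_polys: "(\<lambda>z. a) \<in> polys k"
proof -
  have "(\<lambda>z. 0) \<in> polys k"
    by (auto simp: polys_def intro!: exI[of _ "\<lambda>_. 0"])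
  from polys_affine[OF this, of a 0] show ?thesis by simp
qed

lemma continuous_on_polys:
  assumes "f \<in> polys k"
  shows "continuous_on X f"
  using assms by (auto simp: polys_def case_prod_unfold intro!: continuous_intros)

text \<open>A bounded cell lies in a box, on which a continuous function is absolutely integrable.
  This licenses splitting the integral of a sum in \<open>cell_mean_affine\<close>.\<close>

lemma set_integrable_polys:
  assumes "f \<in> polys k" and "bounded A" and "A \<in> sets lebesgue"
  shows "set_integrable lebesgue A f"
proof -
  obtain a b where "A \<subseteq> cbox a b"
    using bounded_subset_cbox_symmetric[OF \<open>bounded A\<close>] by blast
  then show ?thesis
    using absolutely_integrable_continuous[OF continuous_on_polys[OF assms(1)], of a b] assms(3)
    by (blast intro: set_integrable_subset)
qed

lemma cell_mean_affine:
  assumes "f \<in> polys k" and "bounded A" and "A \<in> sets lebesgue" and "measure lebesgue A > 0"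
  shows "cell_mean A (\<lambda>z. a + b * f z) = a + b * cell_mean A f"
proof -
  have int: "set_integrable lebesgue A f" "set_integrable lebesgue A (\<lambda>z. a)"
    using set_integrable_polys assms const_in_polys by blast+
  have "(LINT z:A|lebesgue. a + b * f z) = (LINT z:A|lebesgue. a) + b * (LINT z:A|lebesgue. f z)"
    using int by (subst set_integral_add) auto
  \<comment> \<open>The mean of the constant is \<open>a\<close> itself only because the positive
    measure can be cancelled afterwards.\<close>
  also have "(LINT z:A|lebesgue. a) = measure lebesgue A * a"
    using assms by (simp add: set_lebesgue_integral_def)
  finally show ?thesis
    using assms(4) by (simp add: cell_mean_def field_simps)
qed

lemma cell_mean_affine_mesh:
  assumes "mesh N I" and "i \<in> {1..N}" and "f \<in> polys k"
  shows "cell_mean (I i) (\<lambda>z. a + b * f z) = a + b * cell_mean (I i) f"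
  using assms by (intro cell_mean_affine) (auto simp: mesh_def)

section \<open>Affine equivariance of direct reconstructions\<close>

lemma interpolants_affine:
  assumes "mesh N I" and "T \<subseteq> {1..N}" and "f \<in> interpolants I T k d"
  shows "(\<lambda>z. a + b * f z) \<in> interpolants I T k (\<lambda>i. a + b * d i)"
  using assms cell_mean_affine_mesh[OF assms(1), of _ f k a b]
  by (auto simp: interpolants_def polys_affine)

text \<open>In every residual the shift \<open>a\<close> cancels and the factor \<open>b\<close>
  comes out, so each term scales by the same power of the absolute value of
  \<open>b\<close>.\<close>

lemma misfit_affine:
  assumes "mesh N I" and "T \<subseteq> {1..N}" and "f \<in> polys k"
  shows "misfit I T \<alpha> q (\<lambda>i. a + b * d i) (\<lambda>z. a + b * f z) = \<bar>b\<bar> powr q * misfit I T \<alpha> q d f"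
proof -
  have "\<bar>cell_mean (I i) (\<lambda>z. a + b * f z) - (a + b * d i)\<bar> powr q =
      \<bar>b\<bar> powr q * \<bar>cell_mean (I i) f - d i\<bar> powr q" if "i \<in> T" for i
  proof -
    have "cell_mean (I i) (\<lambda>z. a + b * f z) - (a + b * d i) = b * (cell_mean (I i) f - d i)"
      using cell_mean_affine_mesh[OF assms(1) _ assms(3)] that assms(2)
      by (auto simp: algebra_simps)
    then show ?thesis
      by (simp add: abs_mult powr_mult)
  qed
  then show ?thesis
    by (simp add: misfit_def sum_distrib_left mult_ac)
qed

lemma misfit_nonneg:
  assumes "\<forall>i\<in>T. \<alpha> i > 0"
  shows "misfit I T \<alpha> q d f \<ge> 0"
  unfolding misfit_def using assms
  by (intro sum_nonneg mult_nonneg_nonneg) (auto intro: less_imp_le)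

text \<open>For nonzero \<open>b\<close> the affine map is invertible and carries the competitors
  for \<open>d\<close> onto those for the transformed data, with all misfits scaled by one positive
  factor. The degenerate case \<open>b = 0\<close> needs its own argument.\<close>

lemma direct_solutions_affine:
  assumes mesh: "mesh N I" and S: "S \<subseteq> {1..N}" "S\<^sub>0 \<subseteq> S" and \<alpha>: "\<forall>i\<in>S - S\<^sub>0. \<alpha> i > 0"
    and f: "f \<in> direct_solutions I S S\<^sub>0 k \<alpha> q d"
  shows "(\<lambda>z. a + b * f z) \<in> direct_solutions I S S\<^sub>0 k \<alpha> q (\<lambda>i. a + b * d i)"
proof -
  let ?m = "misfit I (S - S\<^sub>0) \<alpha> q"
  let ?d = "\<lambda>i. a + b * d i" and ?f = "\<lambda>z. a + b * f z"
  have S0: "S\<^sub>0 \<subseteq> {1..N}" and T: "S - S\<^sub>0 \<subseteq> {1..N}"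
    using S by auto
  have fi: "f \<in> interpolants I S\<^sub>0 k d"
    using f by (simp add: direct_solutions_def)
  then have fp: "f \<in> polys k"
    by (simp add: interpolants_def)
  have "?m ?d ?f \<le> ?m ?d g" if big: "card S > dof k" and g: "g \<in> interpolants I S\<^sub>0 k ?d" for g
  proof (cases "b = 0")
    case True
    \<comment> \<open>All data equal \<open>a\<close>, and the constant polynomial \<open>a\<close>
      has misfit zero, the least value possible with positive weights.\<close>
    then show ?thesis
      using misfit_affine[OF mesh T fp, of \<alpha> q a b d] misfit_nonneg[OF \<alpha>] by simp
  next
    case False
    \<comment> \<open>Undoing the affine map turns the competitor \<open>g\<close> into a competitor
      \<open>h\<close> for the original data, where \<open>f\<close> is already known to be
      minimal.\<close>
    define h where "h = (\<lambda>z. - a / b + 1 / b * g z)"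
    have h: "h \<in> interpolants I S\<^sub>0 k d"
      using interpolants_affine[OF mesh S0 g, of "- a / b" "1 / b"] False
      by (simp add: h_def field_simps)
    have "?m d f \<le> ?m d h"
      using f h big by (auto simp: direct_solutions_def is_arg_min_linorder)
    then have "\<bar>b\<bar> powr q * ?m d f \<le> \<bar>b\<bar> powr q * ?m d h"
      by (simp add: mult_left_mono)
    moreover have "h \<in> polys k"
      using h by (simp add: interpolants_def)
    moreover have "(\<lambda>z. a + b * h z) = g"
      using False by (simp add: h_def field_simps)
    ultimately show ?thesis
      using misfit_affine[OF mesh T, of _ k \<alpha> q a b d] fp by metis
  qed
  then show ?thesis
    using interpolants_affine[OF mesh S0 fi]
    by (auto simp: direct_solutions_def is_arg_min_linorder)
qed

text \<open>The operator takes data on all indices, but the equilibrium relations hold only on the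
  stencil; constraints and misfit see nothing beyond \<open>S\<close>.\<close>

lemma direct_solutions_cong:
  assumes "S\<^sub>0 \<subseteq> S" and "\<And>i. i \<in> S \<Longrightarrow> d i = d' i"
  shows "direct_solutions I S S\<^sub>0 k \<alpha> q d = direct_solutions I S S\<^sub>0 k \<alpha> q d'"
proof -
  have "interpolants I S\<^sub>0 k d = interpolants I S\<^sub>0 k d'"
    using assms by (auto simp: interpolants_def)
  moreover have "misfit I (S - S\<^sub>0) \<alpha> q d = misfit I (S - S\<^sub>0) \<alpha> q d'"
    using assms by (auto simp: misfit_def fun_eq_iff intro!: sum.cong)
  ultimately show ?thesis
    by (simp add: direct_solutions_def)
qed

text \<open>Since the choice of \<open>S\<^sub>0\<close>, \<alpha> and \<open>q\<close> is the same
  for all data, both data sets pose the same kind of problem, and singleton solution sets turn the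
  relation between solutions into an equation for \<open>R\<close>.\<close>

lemma direct_reconstruction_affine:
  assumes mesh: "mesh N I" and S: "S \<subseteq> {1..N}" and R: "direct_reconstruction I i\<^sub>0 S k R"
    and d': "\<And>i. i \<in> S \<Longrightarrow> d' i = a + b * d i"
  shows "R d' z = a + b * R d z"
proof -
  obtain S\<^sub>0 \<alpha> q where S0: "S\<^sub>0 \<subseteq> S" and \<alpha>: "\<forall>i\<in>S - S\<^sub>0. \<alpha> i > 0"
    and sol: "\<And>d. direct_solutions I S S\<^sub>0 k \<alpha> q d = {R d}"
    using R by (auto simp: direct_reconstruction_def)
  have "(\<lambda>z. a + b * R d z) \<in> direct_solutions I S S\<^sub>0 k \<alpha> q (\<lambda>i. a + b * d i)"
    using direct_solutions_affine[OF mesh S S0 \<alpha>] sol by blast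
  also have "\<dots> = {R d'}"
    using direct_solutions_cong[OF S0, of d' "\<lambda>i. a + b * d i"] d' sol by metis
  finally show ?thesis
    by (metis singletonD)
qed

section \<open>Selected weights, equilibrium states and the unified reconstruction\<close>

lemma unified_index_range: "unified_index r lw \<omega> \<in> {1..4}"
proof -
  let ?f = "weight_deviation r lw \<omega>"
  let ?A = "{j. is_arg_max ?f (\<lambda>j. j \<in> {1..4}) j}"
  have sub: "?A \<subseteq> {1..4}"
    by (auto simp: is_arg_max_def)
  \<comment> \<open>\<open>Min\<close> is a member of its set only if that set is finite and
    nonempty; a maximizer over the four components gives nonemptiness.\<close>
  obtain j where "j \<in> {1..4}" "?f j = Max (?f ` {1..4})"
    using Max_in[of "?f ` {1..4}"] by fastforce
  then have "j \<in> ?A"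
    by (auto simp: is_arg_max_linorder)
  then have "Min ?A \<in> ?A"
    using finite_subset[OF sub] by (intro Min_in) auto
  then show ?thesis
    using sub unfolding unified_index_def by blast
qed

lemma eq_equilibrium_state_iff:
  "U = equilibrium_state v p \<gamma> B \<rho> \<longleftrightarrow>
     U $ 1 = \<rho> \<and> U $ 2 = \<rho> * v $ 1 \<and> U $ 3 = \<rho> * v $ 2 \<and>
     U $ 4 = (p + \<gamma> * B) / (\<gamma> - 1) + 1 / 2 * \<rho> * (norm v)\<^sup>2"
  by (auto simp: vec_eq_iff forall_4 equilibrium_state_def)

text \<open>Nonzero density allows solving for the momentum, and \<open>\<gamma> > 1\<close> for the
  energy. One direction is applied to the cell averages, the other to the reconstructed
  state.\<close>

lemma has_velocity_pressure_iff:
  assumes "\<gamma> > 1" and "mass_density U \<noteq> 0"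
  shows "has_velocity_pressure \<gamma> B v p U \<longleftrightarrow> U = equilibrium_state v p \<gamma> B (mass_density U)"
proof -
  have "velocity U = v \<longleftrightarrow>
      U $ 2 = mass_density U * v $ 1 \<and> U $ 3 = mass_density U * v $ 2"
    using assms(2) by (auto simp: velocity_def momentum_def vec_eq_iff forall_2 field_simps)
  moreover have "pressure \<gamma> B U = p \<longleftrightarrow>
      U $ 4 = (p + \<gamma> * B) / (\<gamma> - 1) + 1 / 2 * mass_density U * (norm v)\<^sup>2" if "velocity U = v"
    using assms(1) that
    by (auto simp: pressure_def internal_energy_def total_energy_def field_simps)
  ultimately show ?thesis
    unfolding has_velocity_pressure_def eq_equilibrium_state_iff by (auto simp: mass_density_def)
qed

lemma unified_weno_equilibrium:
  assumes mesh: "mesh N I"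
    and weno: "\<And>j. j \<in> {1..4} \<Longrightarrow> weno_scheme N I i\<^sub>0 z\<^sub>0 r S deg R K Q lw (\<beta> j) (w j)"
    and eq: "\<And>i. i \<in> (\<Union>k\<in>{1..r}. S k) \<Longrightarrow>
      U i = equilibrium_state v p \<gamma> B (mass_density (U i))"
  shows "unified_weno z\<^sub>0 r R lw \<beta> w U =
    equilibrium_state v p \<gamma> B (mass_density (unified_weno z\<^sub>0 r R lw \<beta> w U))"
proof -
  define \<omega> where "\<omega> = componentwise_weights R lw \<beta> w U"
  define \<mu> where "\<mu> = \<omega> (unified_index r lw \<omega>)"
  have sum1: "(\<Sum>k = 1..r. \<mu> k) = 1"
    using weno[OF unified_index_range[of r lw \<omega>]]
    by (simp add: weno_scheme_def \<mu>_def \<omega>_def componentwise_weights_def)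
  have comp: "unified_weno z\<^sub>0 r R lw \<beta> w U $ l = (\<Sum>k = 1..r. \<mu> k * R k (\<lambda>i. U i $ l) z\<^sub>0)" for l
    by (simp add: unified_weno_def Let_def \<mu>_def \<omega>_def vector_reconstruction_def)
  \<comment> \<open>Unification enters here: the same \<open>\<mu> k\<close> multiplies component
    \<open>l\<close> and the density, and the intercept \<open>a\<close> survives because these
    weights sum to one.\<close>
  have affine: "unified_weno z\<^sub>0 r R lw \<beta> w U $ l = a + b * unified_weno z\<^sub>0 r R lw \<beta> w U $ 1"
    if l: "\<And>i. i \<in> (\<Union>k\<in>{1..r}. S k) \<Longrightarrow> U i $ l = a + b * U i $ 1" for l a b
  proof -
    have "R k (\<lambda>i. U i $ l) z\<^sub>0 = a + b * R k (\<lambda>i. U i $ 1) z\<^sub>0" if "k \<in> {1..r}" for k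
    proof (rule direct_reconstruction_affine[where R = "R k", OF mesh])
      show "S k \<subseteq> {1..N}" and "direct_reconstruction I i\<^sub>0 (S k) (deg k) (R k)"
        \<comment> \<open>Stencils and polynomial reconstructions are shared by all components, so
          the scheme of any one of them supplies these facts.\<close>
        using weno[of 1] that by (simp_all add: weno_scheme_def)
      show "U i $ l = a + b * U i $ 1" if "i \<in> S k" for i
        using l that \<open>k \<in> {1..r}\<close> by blast
    qed
    then have "(\<Sum>k = 1..r. \<mu> k * R k (\<lambda>i. U i $ l) z\<^sub>0) =
        (\<Sum>k = 1..r. a * \<mu> k + b * (\<mu> k * R k (\<lambda>i. U i $ 1) z\<^sub>0))"
      by (intro sum.cong) (auto simp: algebra_simps)
    also have "\<dots> = a + b * (\<Sum>k = 1..r. \<mu> k * R k (\<lambda>i. U i $ 1) z\<^sub>0)"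
      by (simp only: sum.distrib sum1 mult_1_right flip: sum_distrib_left)
    finally show ?thesis
      by (simp add: comp)
  qed
  note U = eq[unfolded eq_equilibrium_state_iff mass_density_def]
  show ?thesis
    unfolding eq_equilibrium_state_iff mass_density_def
    \<comment> \<open>Momentum is proportional to density with slope \<open>v\<close>; energy has
      the internal part as intercept and half the squared speed as slope.\<close>
    using affine[of 2 0 "v $ 1"] affine[of 3 0 "v $ 2"]
      affine[of 4 "(p + \<gamma> * B) / (\<gamma> - 1)" "1 / 2 * (norm v)\<^sup>2"] U
    by (simp add: mult_ac)
qed

theorem mainTheorem5:
  fixes N :: nat and I :: "nat \<Rightarrow> point set" and i\<^sub>0 :: nat and z\<^sub>0 :: point
    and r :: nat and S :: "nat \<Rightarrow> nat set" and deg :: "nat \<Rightarrow> nat"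
    and R :: "nat \<Rightarrow> (nat \<Rightarrow> real) \<Rightarrow> point \<Rightarrow> real"
    and K :: nat and Q :: "(nat \<Rightarrow> real) \<Rightarrow> point \<Rightarrow> real"
    and lw :: "nat \<Rightarrow> real"
    and \<beta> :: "nat \<Rightarrow> nat \<Rightarrow> (point \<Rightarrow> real) \<Rightarrow> real"
    and w :: "nat \<Rightarrow> (nat \<Rightarrow> real) \<Rightarrow> (nat \<Rightarrow> real) \<Rightarrow> nat \<Rightarrow> real"
    and material :: "nat \<Rightarrow> 'm" and \<gamma> B :: "'m \<Rightarrow> real" and m :: 'm
    and Utot :: "nat \<Rightarrow> state" and v :: "real ^ 2" and p :: real
  defines "C \<equiv> (\<Union>k\<in>{1..r}. S k)"
    and "U \<equiv> cell_average I Utot"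
    and "qWENO \<equiv> unified_weno z\<^sub>0 r R lw \<beta> w"
  assumes "mesh N I"
    and "\<And>j. j \<in> {1..4} \<Longrightarrow> weno_scheme N I i\<^sub>0 z\<^sub>0 r S deg R K Q lw (\<beta> j) (w j)"
    and "\<And>a. \<gamma> a > 1" and "\<And>a. B a \<ge> 0"
  shows "((\<forall>i\<in>C. material i = m) \<and>
          (\<forall>i\<in>C. mass_density (U i) > 0 \<and>
             has_velocity_pressure (\<gamma> (material i)) (B (material i)) v p (U i))
          \<longrightarrow> qWENO U = equilibrium_state v p (\<gamma> m) (B m) (mass_density (qWENO U)) \<and>
              (mass_density (qWENO U) > 0 \<longrightarrow> qWENO U \<in> equilibrium_set v p (\<gamma> m) (B m))) \<and>
         equilibrium_compatible C qWENO"
proof -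
  note weno = unified_weno_equilibrium[where \<beta> = \<beta> and w = w, OF assms(4,5),
      folded qWENO_def C_def]
  show ?thesis
  proof (intro conjI impI)
    let ?\<rho> = "mass_density (qWENO U)"
    assume hyp: "(\<forall>i\<in>C. material i = m) \<and>
      (\<forall>i\<in>C. mass_density (U i) > 0 \<and>
         has_velocity_pressure (\<gamma> (material i)) (B (material i)) v p (U i))"
    show state: "qWENO U = equilibrium_state v p (\<gamma> m) (B m) ?\<rho>"
    proof (rule weno)
      fix i assume "i \<in> C"
      with hyp show "U i = equilibrium_state v p (\<gamma> m) (B m) (mass_density (U i))"
        using has_velocity_pressure_iff[OF assms(6)] by fastforce
    qed
    assume "?\<rho> > 0"
    with state show "qWENO U \<in> equilibrium_set v p (\<gamma> m) (B m)"
      unfolding equilibrium_set_def by blast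
  next
    show "equilibrium_compatible C qWENO"
      unfolding equilibrium_compatible_def
    proof (intro allI impI)
      \<comment> \<open>These names shadow those of the theorem: the EC property ranges over all
        parameters and all averages, not only \<open>cell_average I Utot\<close>.\<close>
      fix \<gamma> B :: real and v p and U :: "nat \<Rightarrow> state"
      assume "\<gamma> > 1" and "mass_density (qWENO U) \<noteq> 0"
        and C: "\<forall>i\<in>C. mass_density (U i) > 0 \<and> has_velocity_pressure \<gamma> B v p (U i)"
      have "qWENO U = equilibrium_state v p \<gamma> B (mass_density (qWENO U))"
      proof (rule weno)
        fix i assume "i \<in> C"
        with C show "U i = equilibrium_state v p \<gamma> B (mass_density (U i))"
          using has_velocity_pressure_iff[OF \<open>\<gamma> > 1\<close>] by fastforce
      qed
      then show "has_velocity_pressure \<gamma> B v p (qWENO U)"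
        using has_velocity_pressure_iff \<open>\<gamma> > 1\<close> \<open>mass_density (qWENO U) \<noteq> 0\<close> by blast
    qed
  qed
qed

end
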